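(* Let $X$ be a Tychonoff space. The following are equivalent: (1) $C_p(X)$ is strictly H-bounded; (2) $C_p(X)$ is H-bounded; (3) $C_p(X)$ is strictly M-bounded; (4) $C_p(X)$ is M-bounded; (5) $X$ is pseudocompact; (6) $C_m(X)$ is first countable; (7) $C_m(X)$ is strictly Fréchet–Urysohn; (8) $C_m(X)$ has countable strong fan tightness; (9) $C_m(X)$ has countable fan tightness; (10) $C_m(X)$ has countable tightness; (11) $C_m(X)$ is completely metrizable; (12) $C_m(X)$ is Čech-complete; (13) $C_m(X)$ is hereditarily Baire.
   Context: $C(X)$ is the set of continuous real-valued functions on a Tychonoff space $X$, regarded as a Hausdorff topological group under pointwise addition with identity the constant zero function $f_0$. $C_p(X)$ is $C(X)$ with the topology of pointwise convergence (basic neighborhoods of $f$: $\{g:|g(x)-f(x)|<\varepsilon \ \forall x\in F\}$, $F\subset X$ finite, $\varepsilon>0$). $C_m(X)$ is $C(X)$ with the $m$-topology (fine/Whitney topology): basic neighborhoods of $f$ are $\{g\in C(X): |g(x)-f(x)|<\varepsilon(x)\ \forall x\in X\}$ where $\varepsilon\in C(X)$ is strictly positive. For a topological group $G$ with identity $e$: $G$ is M-bounded (Menger-bounded) if for every sequence $(U_n)_{n\in\mathbb N}$ of neighborhoods of $e$ there are finite sets $A_n\subset G$ with $G=\bigcup_n A_n\cdot U_n$; $G$ is H-bounded (Hurewicz-bounded) if for every such sequence there are finite $A_n\subset G$ such that each $x\in G$ belongs to $A_n\cdot U_n$ for all but finitely many $n$. The M-game on $G$: in round $n$ player ONE chooses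 a (basic) neighborhood $U_n$ of $e$ and TWO responds with a finite set $A_n\subset G$; TWO wins if $G=\bigcup_n A_nU_n$. $G$ is strictly M-bounded if TWO has a winning strategy in this game. Strictly H-bounded is defined analogously, TWO winning when each $x\in G$ lies in all but finitely many $A_nU_n$. A space $Y$ has countable tightness if whenever $y\in\overline{A}$ there is countable $B\subset A$ with $y\in\overline B$; countable fan tightness if for every $y$ and every sequence $(A_n)$ with $y\in\bigcap_n\overline{A_n}$ there are finite $B_n\subset A_n$ with $y\in\overline{\bigcup_n B_n}$; countable strong fan tightness if in the same situation there are points $b_n\in A_n$ with $y\in\overline{\{b_n:n\in\mathbb N\}}$; $Y$ is strictly Fréchet–Urysohn if for every $y$ and every sequence $(A_n)$ with $y\in\bigcap_n \overline{A_n}$ there are $a_n\in A_n$ with $a_n\to y$. Hereditarily Baire means every closed subspace is a Baire space. *)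

theory Defs
  imports "HOL-Analysis.Analysis" "HOL-Library.Function_Algebras"
begin

definition Tychonoff_space :: "'a topology \<Rightarrow> bool" where
  "Tychonoff_space X \<longleftrightarrow> completely_regular_space X \<and> Hausdorff_space X"

definition pseudocompact :: "'a topology \<Rightarrow> bool" where
  "pseudocompact X \<longleftrightarrow>
     (\<forall>f::'a \<Rightarrow> real. continuous_map X euclideanreal f \<longrightarrow> bounded (f ` topspace X))"

text \<open>Continuous real functions on X, normalised to be 0 outside the carrier,
  so that each element of C(X) is represented by exactly one HOL function.\<close>
definition CX :: "'a topology \<Rightarrow> ('a \<Rightarrow> real) set" where
  "CX X = {f. continuous_map X euclideanreal f \<and> (\<forall>x. x \<notin> topspace X \<longrightarrow> f x = 0)}"

definition Cp :: "'a topology \<Rightarrow> ('a \<Rightarrow> real) topology" where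
  "Cp X = topology (\<lambda>U. U \<subseteq> CX X \<and>
     (\<forall>f\<in>U. \<exists>F e. finite F \<and> F \<subseteq> topspace X \<and> e > 0 \<and>
        {g \<in> CX X. \<forall>x\<in>F. \<bar>g x - f x\<bar> < e} \<subseteq> U))"

definition Cm :: "'a topology \<Rightarrow> ('a \<Rightarrow> real) topology" where
  "Cm X = topology (\<lambda>U. U \<subseteq> CX X \<and>
     (\<forall>f\<in>U. \<exists>e\<in>CX X. (\<forall>x\<in>topspace X. e x > 0) \<and>
        {g \<in> CX X. \<forall>x\<in>topspace X. \<bar>g x - f x\<bar> < e x} \<subseteq> U))"

definition set_plus_of :: "'g::plus set \<Rightarrow> 'g set \<Rightarrow> 'g set" where
  "set_plus_of A U = {a + u | a u. a \<in> A \<and> u \<in> U}"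

definition nbhd0 :: "'g::zero topology \<Rightarrow> 'g set \<Rightarrow> bool" where
  "nbhd0 T U \<longleftrightarrow> (\<exists>V. openin T V \<and> 0 \<in> V \<and> V \<subseteq> U)"

definition M_bounded :: "'g::{plus,zero} topology \<Rightarrow> bool" where
  "M_bounded T \<longleftrightarrow> (\<forall>U::nat \<Rightarrow> 'g set. (\<forall>n. nbhd0 T (U n)) \<longrightarrow>
     (\<exists>A. (\<forall>n. finite (A n) \<and> A n \<subseteq> topspace T) \<and>
          topspace T \<subseteq> (\<Union>n. set_plus_of (A n) (U n))))"

definition H_bounded :: "'g::{plus,zero} topology \<Rightarrow> bool" where
  "H_bounded T \<longleftrightarrow> (\<forall>U::nat \<Rightarrow> 'g set. (\<forall>n. nbhd0 T (U n)) \<longrightarrow>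
     (\<exists>A. (\<forall>n. finite (A n) \<and> A n \<subseteq> topspace T) \<and>
          (\<forall>x\<in>topspace T. \<forall>\<^sub>F n in sequentially. x \<in> set_plus_of (A n) (U n))))"

text \<open>Games: a strategy of TWO maps the list [U_0,...,U_n] of ONE's moves so far
  to TWO's answer A_n (TWO's own earlier moves are determined by the strategy).\<close>
definition strictly_M_bounded :: "'g::{plus,zero} topology \<Rightarrow> bool" where
  "strictly_M_bounded T \<longleftrightarrow> (\<exists>\<sigma>::'g set list \<Rightarrow> 'g set.
     \<forall>U::nat \<Rightarrow> 'g set. (\<forall>n. nbhd0 T (U n)) \<longrightarrow>
       (\<forall>n. finite (\<sigma> (map U [0..<Suc n])) \<and> \<sigma> (map U [0..<Suc n]) \<subseteq> topspace T) \<and>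
       topspace T \<subseteq> (\<Union>n. set_plus_of (\<sigma> (map U [0..<Suc n])) (U n)))"

definition strictly_H_bounded :: "'g::{plus,zero} topology \<Rightarrow> bool" where
  "strictly_H_bounded T \<longleftrightarrow> (\<exists>\<sigma>::'g set list \<Rightarrow> 'g set.
     \<forall>U::nat \<Rightarrow> 'g set. (\<forall>n. nbhd0 T (U n)) \<longrightarrow>
       (\<forall>n. finite (\<sigma> (map U [0..<Suc n])) \<and> \<sigma> (map U [0..<Suc n]) \<subseteq> topspace T) \<and>
       (\<forall>x\<in>topspace T. \<forall>\<^sub>F n in sequentially.
          x \<in> set_plus_of (\<sigma> (map U [0..<Suc n])) (U n)))"

definition countable_tightness :: "'a topology \<Rightarrow> bool" where
  "countable_tightness Y \<longleftrightarrow> (\<forall>A y. A \<subseteq> topspace Y \<and> y \<in> Y closure_of A \<longrightarrow>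
     (\<exists>B. B \<subseteq> A \<and> countable B \<and> y \<in> Y closure_of B))"

definition countable_fan_tightness :: "'a topology \<Rightarrow> bool" where
  "countable_fan_tightness Y \<longleftrightarrow> (\<forall>(A::nat \<Rightarrow> 'a set) y.
     (\<forall>n. A n \<subseteq> topspace Y \<and> y \<in> Y closure_of (A n)) \<longrightarrow>
     (\<exists>B. (\<forall>n. finite (B n) \<and> B n \<subseteq> A n) \<and> y \<in> Y closure_of (\<Union>n. B n)))"

definition countable_strong_fan_tightness :: "'a topology \<Rightarrow> bool" where
  "countable_strong_fan_tightness Y \<longleftrightarrow> (\<forall>(A::nat \<Rightarrow> 'a set) y.
     (\<forall>n. A n \<subseteq> topspace Y \<and> y \<in> Y closure_of (A n)) \<longrightarrow>
     (\<exists>b. (\<forall>n. b n \<in> A n) \<and> y \<in> Y closure_of (range b)))"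

definition strictly_Frechet_Urysohn :: "'a topology \<Rightarrow> bool" where
  "strictly_Frechet_Urysohn Y \<longleftrightarrow> (\<forall>(A::nat \<Rightarrow> 'a set) y.
     (\<forall>n. A n \<subseteq> topspace Y \<and> y \<in> Y closure_of (A n)) \<longrightarrow>
     (\<exists>a. (\<forall>n. a n \<in> A n) \<and> limitin Y a y sequentially))"

definition Baire_space :: "'a topology \<Rightarrow> bool" where
  "Baire_space Y \<longleftrightarrow> (\<forall>G::nat \<Rightarrow> 'a set.
     (\<forall>n. openin Y (G n) \<and> Y closure_of (G n) = topspace Y) \<longrightarrow>
     Y closure_of (\<Inter>n. G n) = topspace Y)"

definition hereditarily_Baire :: "'a topology \<Rightarrow> bool" where
  "hereditarily_Baire Y \<longleftrightarrow> (\<forall>C. closedin Y C \<longrightarrow> Baire_space (subtopology Y C))"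

definition beta_index :: "'a topology \<Rightarrow> ('a \<Rightarrow> real) set" where
  "beta_index Y = {f. continuous_map Y (top_of_set {0..1}) f}"

definition beta_embed :: "'a topology \<Rightarrow> 'a \<Rightarrow> (('a \<Rightarrow> real) \<Rightarrow> real)" where
  "beta_embed Y y = restrict (\<lambda>f. f y) (beta_index Y)"

definition beta_cube :: "'a topology \<Rightarrow> (('a \<Rightarrow> real) \<Rightarrow> real) topology" where
  "beta_cube Y = product_topology (\<lambda>_. top_of_set {0..1}) (beta_index Y)"

definition Stone_Cech :: "'a topology \<Rightarrow> (('a \<Rightarrow> real) \<Rightarrow> real) topology" where
  "Stone_Cech Y = subtopology (beta_cube Y) (beta_cube Y closure_of (beta_embed Y ` topspace Y))"

definition Cech_complete :: "'a topology \<Rightarrow> bool" where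
  "Cech_complete Y \<longleftrightarrow> Tychonoff_space Y \<and>
     gdelta_in (Stone_Cech Y) (beta_embed Y ` topspace Y)"

end

theory Submission
  imports Defs
begin

text \<open>If \<open>X\<close> is pseudocompact, then the functions bounded by \<open>n\<close> form a totally bounded subset of
  \<open>C\<^sub>p(X)\<close>, and TWO wins by covering these in round \<open>n\<close>; moreover a strictly positive continuous
  function is bounded away from 0, so the \<open>m\<close>-topology is that of the complete supremum metric.

  If \<open>X\<close> is not pseudocompact, an unbounded function yields points \<open>x n\<close> on which every real
  sequence is interpolated by some element of \<open>C(X)\<close>. Diagonalising along these points shows that
  \<open>C\<^sub>p(X)\<close> is not M-bounded, and that 0 is in the closure of the positive functions in \<open>C\<^sub>m(X)\<close> but
  not of any countable set of them. Finally, the functions vanishing at almost all \<open>x n\<close> form a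
  closed subspace of \<open>C\<^sub>m(X)\<close> that is a countable union of closed nowhere dense sets.\<close>

section \<open>Arithmetic in C(X) and the open sets of the two function space topologies\<close>

lemma CX_continuous_map: "f \<in> CX X \<Longrightarrow> continuous_map X euclideanreal f"
  by (simp add: CX_def)

lemma CX_extend_zero:
  assumes "continuous_map X euclideanreal h"
  shows "(\<lambda>x. if x \<in> topspace X then h x else 0) \<in> CX X"
  using continuous_map_eq[OF assms, of "\<lambda>x. if x \<in> topspace X then h x else 0"]
  by (auto simp: CX_def)

lemma CX_zero: "0 \<in> CX X"
  by (simp add: CX_def zero_fun_def)

lemma CX_add: "f \<in> CX X \<Longrightarrow> g \<in> CX X \<Longrightarrow> (\<lambda>x. f x + g x) \<in> CX X"
  by (auto simp: CX_def intro!: continuous_intros)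

lemma CX_diff: "f \<in> CX X \<Longrightarrow> g \<in> CX X \<Longrightarrow> (\<lambda>x. f x - g x) \<in> CX X"
  by (auto simp: CX_def intro!: continuous_intros)

lemma CX_mult: "f \<in> CX X \<Longrightarrow> g \<in> CX X \<Longrightarrow> (\<lambda>x. f x * g x) \<in> CX X"
  by (auto simp: CX_def intro!: continuous_intros)

lemma CX_abs: "f \<in> CX X \<Longrightarrow> (\<lambda>x. \<bar>f x\<bar>) \<in> CX X"
  by (auto simp: CX_def intro!: continuous_intros)

text \<open>The constant \<open>topology\<close> can be unfolded only for a predicate satisfying
  \<open>istopology\<close>. For intersections, the union of the two finite sets and the smaller
  radius work.\<close>

lemma openin_Cp:
  "openin (Cp X) U \<longleftrightarrow> U \<subseteq> CX X \<and>
     (\<forall>f\<in>U. \<exists>F e. finite F \<and> F \<subseteq> topspace X \<and> e > 0 \<and>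
        {g \<in> CX X. \<forall>x\<in>F. \<bar>g x - f x\<bar> < e} \<subseteq> U)"
proof -
  define P where "P \<equiv> \<lambda>U. U \<subseteq> CX X \<and>
     (\<forall>f\<in>U. \<exists>F e. finite F \<and> F \<subseteq> topspace X \<and> e > 0 \<and>
        {g \<in> CX X. \<forall>x\<in>F. \<bar>g x - f x\<bar> < (e::real)} \<subseteq> U)"
  have "istopology P"
    unfolding istopology_def
  proof (intro conjI allI impI)
    fix S T assume S: "P S" and T: "P T"
    show "P (S \<inter> T)"
      unfolding P_def
    proof (intro conjI ballI)
      show "S \<inter> T \<subseteq> CX X"
        using S unfolding P_def by blast
      fix f assume f: "f \<in> S \<inter> T"
      then obtain F e where F: "finite F" "F \<subseteq> topspace X" "e > 0"
        "{g \<in> CX X. \<forall>x\<in>F. \<bar>g x - f x\<bar> < (e::real)} \<subseteq> S"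
        using S unfolding P_def by blast
      obtain F' e' where F': "finite F'" "F' \<subseteq> topspace X" "e' > 0"
        "{g \<in> CX X. \<forall>x\<in>F'. \<bar>g x - f x\<bar> < (e'::real)} \<subseteq> T"
        using T f unfolding P_def by blast
      show "\<exists>F e. finite F \<and> F \<subseteq> topspace X \<and> e > 0 \<and>
        {g \<in> CX X. \<forall>x\<in>F. \<bar>g x - f x\<bar> < (e::real)} \<subseteq> S \<inter> T"
      proof (intro exI conjI)
        show "{g \<in> CX X. \<forall>x\<in>F \<union> F'. \<bar>g x - f x\<bar> < min e e'} \<subseteq> S \<inter> T"
          using F(4) F'(4) by auto
      qed (use F F' in auto)
    qed
  next
    fix \<K> assume K: "\<forall>K\<in>\<K>. P K"
    show "P (\<Union>\<K>)"
      unfolding P_def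
    proof (intro conjI ballI)
      show "\<Union>\<K> \<subseteq> CX X"
        using K unfolding P_def by blast
      fix f assume "f \<in> \<Union>\<K>"
      then obtain S where S: "S \<in> \<K>" "f \<in> S" "P S"
        using K by blast
      then show "\<exists>F e. finite F \<and> F \<subseteq> topspace X \<and> e > 0 \<and>
        {g \<in> CX X. \<forall>x\<in>F. \<bar>g x - f x\<bar> < (e::real)} \<subseteq> \<Union>\<K>"
        unfolding P_def by (meson Union_upper order_trans)
    qed
  qed
  then have "openin (topology P) U = P U"
    by (simp add: topology_inverse')
  moreover have "Cp X = topology P"
    unfolding Cp_def P_def by simp
  ultimately show ?thesis
    by (simp add: P_def)
qed

text \<open>As for \<open>openin_Cp\<close>, but two gauges are merged into their pointwise minimum,
  which is again continuous and positive.\<close>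

lemma openin_Cm:
  "openin (Cm X) U \<longleftrightarrow> U \<subseteq> CX X \<and>
     (\<forall>f\<in>U. \<exists>e\<in>CX X. (\<forall>x\<in>topspace X. e x > 0) \<and>
        {g \<in> CX X. \<forall>x\<in>topspace X. \<bar>g x - f x\<bar> < e x} \<subseteq> U)"
proof -
  define P where "P \<equiv> \<lambda>U. U \<subseteq> CX X \<and>
     (\<forall>f\<in>U. \<exists>e\<in>CX X. (\<forall>x\<in>topspace X. e x > 0) \<and>
        {g \<in> CX X. \<forall>x\<in>topspace X. \<bar>g x - f x\<bar> < e x} \<subseteq> U)"
  have "istopology P"
    unfolding istopology_def
  proof (intro conjI allI impI)
    fix S T assume S: "P S" and T: "P T"
    show "P (S \<inter> T)"
      unfolding P_def
    proof (intro conjI ballI)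
      show "S \<inter> T \<subseteq> CX X"
        using S unfolding P_def by blast
      fix f assume f: "f \<in> S \<inter> T"
      then obtain e where e: "e \<in> CX X" "\<forall>x\<in>topspace X. e x > 0"
        "{g \<in> CX X. \<forall>x\<in>topspace X. \<bar>g x - f x\<bar> < e x} \<subseteq> S"
        using S unfolding P_def by blast
      obtain e' where e': "e' \<in> CX X" "\<forall>x\<in>topspace X. e' x > 0"
        "{g \<in> CX X. \<forall>x\<in>topspace X. \<bar>g x - f x\<bar> < e' x} \<subseteq> T"
        using T f unfolding P_def by blast
      show "\<exists>e\<in>CX X. (\<forall>x\<in>topspace X. e x > 0) \<and>
        {g \<in> CX X. \<forall>x\<in>topspace X. \<bar>g x - f x\<bar> < e x} \<subseteq> S \<inter> T"
      proof (intro bexI conjI)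
        show "{g \<in> CX X. \<forall>x\<in>topspace X. \<bar>g x - f x\<bar> < min (e x) (e' x)} \<subseteq> S \<inter> T"
          using e(3) e'(3) by auto
        show "(\<lambda>x. min (e x) (e' x)) \<in> CX X"
          using e(1) e'(1) by (auto simp: CX_def intro!: continuous_map_real_min)
      qed (use e e' in auto)
    qed
  next
    fix \<K> assume K: "\<forall>K\<in>\<K>. P K"
    show "P (\<Union>\<K>)"
      unfolding P_def
    proof (intro conjI ballI)
      show "\<Union>\<K> \<subseteq> CX X"
        using K unfolding P_def by blast
      fix f assume "f \<in> \<Union>\<K>"
      then obtain S where S: "S \<in> \<K>" "f \<in> S" "P S"
        using K by blast
      then show "\<exists>e\<in>CX X. (\<forall>x\<in>topspace X. e x > 0) \<and>
        {g \<in> CX X. \<forall>x\<in>topspace X. \<bar>g x - f x\<bar> < e x} \<subseteq> \<Union>\<K>"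
        unfolding P_def by (meson Union_upper order_trans)
    qed
  qed
  then have "openin (topology P) U = P U"
    by (simp add: topology_inverse')
  moreover have "Cm X = topology P"
    unfolding Cm_def P_def by simp
  ultimately show ?thesis
    by (simp add: P_def)
qed

text \<open>The cut-off keeps constants inside \<open>CX X\<close>, whose members vanish off the
  carrier.\<close>

lemma CX_const: "(\<lambda>x. if x \<in> topspace X then c else 0) \<in> CX X"
  by (rule CX_extend_zero) simp

lemma topspace_Cp [simp]: "topspace (Cp X) = CX X"
proof (rule antisym)
  show "topspace (Cp X) \<subseteq> CX X"
    using openin_topspace[of "Cp X"] unfolding openin_Cp by (rule conjunct1)
  have "openin (Cp X) (CX X)"
    unfolding openin_Cp by (auto intro!: exI[of _ "{}"] exI[of _ "1::real"])
  then show "CX X \<subseteq> topspace (Cp X)"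
    by (rule openin_subset)
qed

lemma topspace_Cm [simp]: "topspace (Cm X) = CX X"
proof (rule antisym)
  show "topspace (Cm X) \<subseteq> CX X"
    using openin_topspace[of "Cm X"] unfolding openin_Cm by (rule conjunct1)
  have "openin (Cm X) (CX X)"
    unfolding openin_Cm by (auto intro!: bexI[OF _ CX_const[of X 1]])
  then show "CX X \<subseteq> topspace (Cm X)"
    by (rule openin_subset)
qed

text \<open>The slack \<open>e x - \<bar>g x - f x\<bar>\<close> left at a member \<open>g\<close>
  is itself a continuous positive gauge, and by the triangle inequality its ball around
  \<open>g\<close> stays inside.\<close>

lemma openin_Cm_ball:
  assumes "f \<in> CX X" "e \<in> CX X"
  shows "openin (Cm X) {g \<in> CX X. \<forall>x\<in>topspace X. \<bar>g x - f x\<bar> < e x}"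
  unfolding openin_Cm
proof (intro conjI ballI)
  fix g assume g: "g \<in> {g \<in> CX X. \<forall>x\<in>topspace X. \<bar>g x - f x\<bar> < e x}"
  show "\<exists>e'\<in>CX X. (\<forall>x\<in>topspace X. e' x > 0) \<and>
        {h \<in> CX X. \<forall>x\<in>topspace X. \<bar>h x - g x\<bar> < e' x}
        \<subseteq> {g \<in> CX X. \<forall>x\<in>topspace X. \<bar>g x - f x\<bar> < e x}"
  proof (intro bexI conjI)
    show "(\<lambda>x. e x - \<bar>g x - f x\<bar>) \<in> CX X"
      using g assms by (intro CX_diff CX_abs) auto
    show "{h \<in> CX X. \<forall>x\<in>topspace X. \<bar>h x - g x\<bar> < e x - \<bar>g x - f x\<bar>}
        \<subseteq> {g \<in> CX X. \<forall>x\<in>topspace X. \<bar>g x - f x\<bar> < e x}"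
      by fastforce
  qed (use g in auto)
qed auto

text \<open>Testing on basic balls suffices, so later closure arguments in \<open>Cm X\<close>
  amount to choosing or meeting a single gauge.\<close>

lemma in_closure_of_Cm:
  "f \<in> Cm X closure_of A \<longleftrightarrow> f \<in> CX X \<and>
     (\<forall>e\<in>CX X. (\<forall>x\<in>topspace X. e x > 0) \<longrightarrow>
        (\<exists>a\<in>A \<inter> CX X. \<forall>x\<in>topspace X. \<bar>a x - f x\<bar> < e x))"
  (is "?L \<longleftrightarrow> ?R")
proof
  assume L: ?L
  then have f: "f \<in> CX X"
    by (simp add: in_closure_of)
  show ?R
  proof (intro conjI ballI impI f)
    fix e assume e: "e \<in> CX X" "\<forall>x\<in>topspace X. e x > 0"
    have "f \<in> {g \<in> CX X. \<forall>x\<in>topspace X. \<bar>g x - f x\<bar> < e x}"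
      using f e by auto
    moreover have "\<forall>T. f \<in> T \<and> openin (Cm X) T \<longrightarrow> (\<exists>a. a \<in> A \<and> a \<in> T)"
      using L by (simp add: in_closure_of)
    ultimately have "\<exists>a. a \<in> A \<and> a \<in> {g \<in> CX X. \<forall>x\<in>topspace X. \<bar>g x - f x\<bar> < e x}"
      using openin_Cm_ball[OF f e(1)] by (elim allE impE) (rule conjI)
    then show "\<exists>a\<in>A \<inter> CX X. \<forall>x\<in>topspace X. \<bar>a x - f x\<bar> < e x"
      by blast
  qed
next
  assume R: ?R
  show ?L
    unfolding in_closure_of
  proof (intro conjI allI impI)
    fix T assume T: "f \<in> T \<and> openin (Cm X) T"
    then obtain e where e: "e \<in> CX X" "\<forall>x\<in>topspace X. e x > 0"
        "{g \<in> CX X. \<forall>x\<in>topspace X. \<bar>g x - f x\<bar> < e x} \<subseteq> T"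
      unfolding openin_Cm by blast
    with R obtain a where "a \<in> A \<inter> CX X" "\<forall>x\<in>topspace X. \<bar>a x - f x\<bar> < e x"
      by meson
    with e(3) show "\<exists>a. a \<in> A \<and> a \<in> T"
      by blast
  qed (use R in auto)
qed

section \<open>Interpolating sequences\<close>

text \<open>The range of such a sequence is a C-embedded copy of the discrete natural numbers;
  distinctness of the points follows by taking distinct values \<open>c n\<close>.\<close>

definition interpolating :: "'a topology \<Rightarrow> (nat \<Rightarrow> 'a) \<Rightarrow> bool" where
  "interpolating X x \<longleftrightarrow> range x \<subseteq> topspace X \<and>
     (\<forall>c :: nat \<Rightarrow> real. \<exists>h. continuous_map X euclideanreal h \<and> (\<forall>n. h (x n) = c n))"

text \<open>Along suitable points the absolute values of an unbounded function form a uniformly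
  separated set of reals. Any function on that set extends to the line by Tietze, and composition
  moves the interpolation to \<open>X\<close>.\<close>

lemma not_pseudocompact_imp_interpolating:
  assumes "\<not> pseudocompact X"
  shows "\<exists>x. interpolating X x"
proof -
  obtain f :: "'a \<Rightarrow> real" where f: "continuous_map X euclideanreal f"
    and unb: "\<not> bounded (f ` topspace X)"
    using assms unfolding pseudocompact_def by blast
  have big: "\<exists>x\<in>topspace X. \<bar>f x\<bar> > B" for B
    using unb unfolding bounded_iff by (auto simp: not_le)
  \<comment> \<open>Unboundedness always supplies a next point where the absolute value of
    \<open>f\<close> has grown by more than 1.\<close>
  have "\<exists>x. \<forall>n. x n \<in> topspace X \<and> \<bar>f (x (Suc n))\<bar> > \<bar>f (x n)\<bar> + 1"
    by (rule dependent_nat_choice) (use big in blast)+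
  then obtain x where x: "\<And>n. x n \<in> topspace X" "\<And>n. \<bar>f (x (Suc n))\<bar> > \<bar>f (x n)\<bar> + 1"
    by blast
  define t where "t \<equiv> \<lambda>n. \<bar>f (x n)\<bar>"
  have tS: "t n + 1 < t (Suc n)" for n
    using x(2) by (simp add: t_def)
  have mono: "strict_mono t"
    unfolding strict_mono_Suc_iff using tS by (smt (verit))
  have gap: "t n + 1 < t m" if "n < m" for n m
    using tS[of n] strict_mono_less_eq[OF mono, of "Suc n" m] that by linarith
  have sep: "m = n" if "dist (t m) (t n) < 1" for m n
    using gap[of m n] gap[of n m] that by (cases m n rule: linorder_cases) (auto simp: dist_real_def)
  have inj: "inj t"
    using mono by (rule strict_mono_imp_inj_on)
  have cl: "closed (range t)"
    by (rule discrete_imp_closed[of 1]) (auto dest: sep)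
  have "\<exists>h. continuous_map X euclideanreal h \<and> (\<forall>n. h (x n) = c n)" for c :: "nat \<Rightarrow> real"
  proof -
    \<comment> \<open>Points of \<open>range t\<close> at distance below 1 coincide, so 1 serves as
      delta for every epsilon.\<close>
    have "continuous_on (range t) (c \<circ> inv t)"
      unfolding continuous_on_iff
      by (auto intro!: exI[of _ 1] dest!: sep)
    then obtain \<phi> where \<phi>: "continuous_on UNIV \<phi>" "\<And>s. s \<in> range t \<Longrightarrow> \<phi> s = (c \<circ> inv t) s"
      using Tietze_unbounded[of "range t" "c \<circ> inv t" UNIV] cl by auto
    have "continuous_map X euclideanreal (\<phi> \<circ> (\<lambda>x. \<bar>f x\<bar>))"
      using \<phi>(1) f by (intro continuous_map_compose[where X' = euclideanreal]) (auto intro!: continuous_intros)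
    moreover have "(\<phi> \<circ> (\<lambda>x. \<bar>f x\<bar>)) (x n) = c n" for n
      using \<phi>(2)[of "t n"] inj by (simp add: t_def[symmetric] o_def) (simp add: t_def)
    ultimately show ?thesis
      by blast
  qed
  with x(1) show ?thesis
    unfolding interpolating_def by blast
qed

lemma interpolating_in_topspace: "interpolating X x \<Longrightarrow> x n \<in> topspace X"
  by (auto simp: interpolating_def)

lemma interpolating_CX:
  assumes "interpolating X x"
  shows "\<exists>h\<in>CX X. \<forall>n. h (x n) = c n"
proof -
  obtain h where "continuous_map X euclideanreal h" "\<And>n. h (x n) = c n"
    using assms unfolding interpolating_def by meson
  then show ?thesis
    using CX_extend_zero[of X h] interpolating_in_topspace[OF assms]
    by (intro bexI[of _ "\<lambda>x. if x \<in> topspace X then h x else 0"]) auto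
qed

text \<open>Interpolating \<open>ln (c n)\<close> and exponentiating gives positivity on all of
  \<open>X\<close>, not only at the points \<open>x n\<close>, so the result can serve as a
  gauge.\<close>

lemma interpolating_CX_pos:
  assumes "interpolating X x" and pos: "\<And>n. c n > 0"
  shows "\<exists>h\<in>CX X. (\<forall>y\<in>topspace X. h y > 0) \<and> (\<forall>n. h (x n) = c n)"
proof -
  obtain h where h: "h \<in> CX X" "\<And>n. h (x n) = ln (c n)"
    using interpolating_CX[OF assms(1), of "\<lambda>n. ln (c n)"] by blast
  have "continuous_map X euclideanreal (exp \<circ> h)"
    using h(1) by (intro continuous_map_compose[where X' = euclideanreal]) (auto simp: CX_def intro!: continuous_intros)
  from CX_extend_zero[OF this] h(2) pos interpolating_in_topspace[OF assms(1)] show ?thesis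
    by (intro bexI[of _ "\<lambda>x. if x \<in> topspace X then (exp \<circ> h) x else 0"]) auto
qed

section \<open>Boundedness of \<open>C\<^sub>p(X)\<close>\<close>

text \<open>Total boundedness: \<open>U\<close> contains every function that is small on one finite
  set \<open>F\<close>, and the restrictions to \<open>F\<close> of functions bounded by
  \<open>B\<close> lie in a cube that finitely many cells of side \<open>e\<close> cover.\<close>

lemma Cp_nbhd0_finite_net:
  assumes "nbhd0 (Cp X) U"
  obtains A where "finite A" "A \<subseteq> CX X"
    "\<And>f. f \<in> CX X \<Longrightarrow> (\<And>x. x \<in> topspace X \<Longrightarrow> \<bar>f x\<bar> \<le> B) \<Longrightarrow> f \<in> set_plus_of A U"
proof -
  obtain V where V: "openin (Cp X) V" "0 \<in> V" "V \<subseteq> U"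
    using assms unfolding nbhd0_def by blast
  then obtain F e where F: "finite F" "F \<subseteq> topspace X" and e: "e > 0"
    and FV: "{g \<in> CX X. \<forall>x\<in>F. \<bar>g x - 0 x\<bar> < e} \<subseteq> V"
    unfolding openin_Cp by blast
  define Q where "Q = {f \<in> CX X. \<forall>x\<in>topspace X. \<bar>f x\<bar> \<le> B}"
  \<comment> \<open>Functions with the same \<open>\<phi>\<close> differ by less than \<open>e\<close> on \<open>F\<close>, so one representative per value of \<open>\<phi>\<close> suffices.\<close>
  define \<phi> :: "('a \<Rightarrow> real) \<Rightarrow> 'a \<Rightarrow> int" where "\<phi> = (\<lambda>f. \<lambda>x\<in>F. \<lfloor>f x / e\<rfloor>)"
  define A where "A = inv_into Q \<phi> ` (\<phi> ` Q)"
  \<comment> \<open>Each of the finitely many coordinates takes finitely many integer values, so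
    only finitely many cells occur.\<close>
  have "\<phi> ` Q \<subseteq> F \<rightarrow>\<^sub>E {\<lfloor>- B / e\<rfloor>..\<lfloor>B / e\<rfloor>}"
  proof (clarsimp simp: \<phi>_def)
    fix f x assume "f \<in> Q" "x \<in> F"
    then have "- B \<le> f x" "f x \<le> B"
      using F by (force simp: Q_def abs_le_iff)+
    then show "\<lfloor>- (B / e)\<rfloor> \<le> \<lfloor>f x / e\<rfloor> \<and> \<lfloor>f x / e\<rfloor> \<le> \<lfloor>B / e\<rfloor>"
      using e by (intro conjI floor_mono) (auto simp: field_simps)
  qed
  then have "finite (\<phi> ` Q)"
    by (rule finite_subset) (simp add: finite_PiE F(1))
  then have "finite A"
    by (simp add: A_def)
  moreover have "A \<subseteq> CX X"
  proof
    fix a assume "a \<in> A"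
    then have "a \<in> Q"
      by (auto simp: A_def intro: inv_into_into)
    then show "a \<in> CX X"
      by (simp add: Q_def)
  qed
  moreover have "f \<in> set_plus_of A U"
    if f: "f \<in> CX X" "\<And>x. x \<in> topspace X \<Longrightarrow> \<bar>f x\<bar> \<le> B" for f
  proof -
    have fQ: "f \<in> Q"
      using f by (auto simp: Q_def)
    define a where "a = inv_into Q \<phi> (\<phi> f)"
    have a: "a \<in> Q" "\<phi> a = \<phi> f" "a \<in> A"
      using fQ by (auto simp: a_def A_def inv_into_into f_inv_into_f)
    have "\<bar>f x - a x\<bar> < e" if "x \<in> F" for x
    proof -
      have "\<lfloor>f x / e\<rfloor> = \<lfloor>a x / e\<rfloor>"
        using a(2) that unfolding \<phi>_def by (metis restrict_apply')
      then have "\<bar>f x / e - a x / e\<bar> < 1"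
        by linarith
      then have "\<bar>(f x - a x) / e\<bar> < 1"
        by (simp add: diff_divide_distrib)
      then show ?thesis
        using e by (simp add: abs_divide)
    qed
    moreover have "(\<lambda>x. f x - a x) \<in> CX X"
      using f(1) a(1) by (intro CX_diff) (auto simp: Q_def)
    ultimately have "(\<lambda>x. f x - a x) \<in> U"
      using FV V(3) by auto
    moreover have "f = a + (\<lambda>x. f x - a x)"
      by (simp add: plus_fun_def)
    ultimately show ?thesis
      unfolding set_plus_of_def using a(3) by blast
  qed
  ultimately show thesis
    using that by blast
qed

text \<open>In round \<open>n\<close> TWO plays a net for the functions bounded by \<open>n\<close>.
  Each continuous function is bounded by some \<open>B\<close>, hence is caught in every round from
  \<open>B\<close> on.\<close>

lemma pseudocompact_imp_strictly_H_bounded_Cp: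
  assumes "pseudocompact X"
  shows "strictly_H_bounded (Cp X)"
proof -
  have "\<exists>A. \<forall>n U. nbhd0 (Cp X) U \<longrightarrow> finite (A n U) \<and> A n U \<subseteq> CX X \<and>
      (\<forall>f\<in>CX X. (\<forall>x\<in>topspace X. \<bar>f x\<bar> \<le> real n) \<longrightarrow> f \<in> set_plus_of (A n U) U)"
    by (intro choice allI) (metis Cp_nbhd0_finite_net)
  then obtain A where A: "\<And>n U. nbhd0 (Cp X) U \<Longrightarrow> finite (A n U) \<and> A n U \<subseteq> CX X \<and>
      (\<forall>f\<in>CX X. (\<forall>x\<in>topspace X. \<bar>f x\<bar> \<le> real n) \<longrightarrow> f \<in> set_plus_of (A n U) U)"
    by blast
  \<comment> \<open>In round \<open>n\<close> the history has \<open>n + 1\<close> entries, so its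
    length minus 1 is the round number. Beyond that number, the answer depends only on ONE's latest
    move.\<close>
  define \<sigma> where "\<sigma> = (\<lambda>L. A (length L - 1) (last L))"
  have \<sigma>: "\<sigma> (map U [0..<Suc n]) = A n (U n)" for U n
    by (simp add: \<sigma>_def)
  show ?thesis
    unfolding strictly_H_bounded_def
  proof (intro exI[of _ \<sigma>] allI impI conjI ballI)
    fix U :: "nat \<Rightarrow> ('a \<Rightarrow> real) set" assume U: "\<forall>n. nbhd0 (Cp X) (U n)"
    show "finite (\<sigma> (map U [0..<Suc n]))" "\<sigma> (map U [0..<Suc n]) \<subseteq> topspace (Cp X)" for n
      using A[of "U n" n] U by (simp_all only: \<sigma> topspace_Cp)
    fix f assume "f \<in> topspace (Cp X)"
    then have f: "f \<in> CX X"
      by simp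
    then have "bounded (f ` topspace X)"
      using assms by (auto simp: pseudocompact_def dest: CX_continuous_map)
    then obtain B where B: "\<And>x. x \<in> topspace X \<Longrightarrow> \<bar>f x\<bar> \<le> B"
      unfolding bounded_iff by auto
    show "\<forall>\<^sub>F n in sequentially. f \<in> set_plus_of (\<sigma> (map U [0..<Suc n])) (U n)"
      unfolding \<sigma>
    proof (rule eventually_sequentiallyI)
      fix n assume "nat \<lceil>B\<rceil> \<le> n"
      then have "B \<le> real n"
        by linarith
      then show "f \<in> set_plus_of (A n (U n)) (U n)"
        using A[of "U n" n] U f B by (meson order_trans)
    qed
  qed
qed

text \<open>TWO's answers along a given sequence of neighbourhoods are the required finite
  sets.\<close>

lemma strictly_H_bounded_imp_H_bounded: "strictly_H_bounded T \<Longrightarrow> H_bounded T"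
  unfolding strictly_H_bounded_def H_bounded_def by meson

lemma strictly_M_bounded_imp_M_bounded: "strictly_M_bounded T \<Longrightarrow> M_bounded T"
  unfolding strictly_M_bounded_def M_bounded_def by meson

lemma eventually_imp_ex: "\<forall>\<^sub>F n in sequentially. P n \<Longrightarrow> \<exists>n. P n"
  by (rule eventually_happens'[OF sequentially_bot])

lemma H_bounded_imp_M_bounded:
  assumes "H_bounded T"
  shows "M_bounded T"
  unfolding M_bounded_def
proof (intro allI impI)
  fix U :: "nat \<Rightarrow> 'a set" assume "\<forall>n. nbhd0 T (U n)"
  then obtain A where A: "\<forall>n. finite (A n) \<and> A n \<subseteq> topspace T"
    "\<And>x. x \<in> topspace T \<Longrightarrow> \<forall>\<^sub>F n in sequentially. x \<in> set_plus_of (A n) (U n)"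
    using assms unfolding H_bounded_def by meson
  show "\<exists>A. (\<forall>n. finite (A n) \<and> A n \<subseteq> topspace T) \<and> topspace T \<subseteq> (\<Union>n. set_plus_of (A n) (U n))"
    using A(1) eventually_imp_ex[OF A(2)] by (intro exI[of _ A]) auto
qed

lemma strictly_H_bounded_imp_strictly_M_bounded:
  assumes "strictly_H_bounded T"
  shows "strictly_M_bounded T"
proof -
  obtain \<sigma> where \<sigma>: "\<And>U::nat \<Rightarrow> 'a set. (\<forall>n. nbhd0 T (U n)) \<Longrightarrow>
       (\<forall>n. finite (\<sigma> (map U [0..<Suc n])) \<and> \<sigma> (map U [0..<Suc n]) \<subseteq> topspace T) \<and>
       (\<forall>x\<in>topspace T. \<forall>\<^sub>F n in sequentially.
          x \<in> set_plus_of (\<sigma> (map U [0..<Suc n])) (U n))"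
    using assms unfolding strictly_H_bounded_def by blast
  show ?thesis
    unfolding strictly_M_bounded_def
  proof (intro exI[of _ \<sigma>] allI impI conjI subsetI)
    fix U :: "nat \<Rightarrow> 'a set" assume U: "\<forall>n. nbhd0 T (U n)"
    note \<sigma>U = \<sigma>[OF U]
    show "finite (\<sigma> (map U [0..<Suc n]))" for n
      by (rule conjunct1[OF spec[OF conjunct1[OF \<sigma>U]]])
    show "x \<in> \<sigma> (map U [0..<Suc n]) \<Longrightarrow> x \<in> topspace T" for x n
      by (rule subsetD[OF conjunct2[OF spec[OF conjunct1[OF \<sigma>U]]]])
    show "x \<in> (\<Union>n. set_plus_of (\<sigma> (map U [0..<Suc n])) (U n))" if "x \<in> topspace T" for x
      using eventually_imp_ex[OF bspec[OF conjunct2[OF \<sigma>U] that]] by blast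
  qed
qed

lemma nbhd0_Cp_point:
  assumes "p \<in> topspace X"
  shows "nbhd0 (Cp X) {g \<in> CX X. \<bar>g p\<bar> < 1}"
proof -
  have "openin (Cp X) {g \<in> CX X. \<bar>g p\<bar> < 1}"
    unfolding openin_Cp
  proof (intro conjI ballI exI)
    fix f assume f: "f \<in> {g \<in> CX X. \<bar>g p\<bar> < 1}"
    show "{g \<in> CX X. \<forall>x\<in>{p}. \<bar>g x - f x\<bar> < 1 - \<bar>f p\<bar>} \<subseteq> {g \<in> CX X. \<bar>g p\<bar> < 1}"
      by auto
  qed (use assms in auto)
  then show ?thesis
    unfolding nbhd0_def using CX_zero by (intro exI conjI) auto
qed

text \<open>A diagonal argument: \<open>U n\<close> controls only the value at \<open>x n\<close>,
  and interpolation allows a function that escapes the finite set \<open>A n\<close> at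
  \<open>x n\<close> for all \<open>n\<close> at once.\<close>

lemma M_bounded_Cp_imp_pseudocompact:
  assumes "M_bounded (Cp X)"
  shows "pseudocompact X"
proof (rule ccontr)
  assume "\<not> pseudocompact X"
  then obtain x where ip: "interpolating X x"
    using not_pseudocompact_imp_interpolating by blast
  note x = interpolating_in_topspace[OF ip]
  define U where "U = (\<lambda>n. {g \<in> CX X. \<bar>g (x n)\<bar> < 1})"
  have "\<forall>n. nbhd0 (Cp X) (U n)"
    unfolding U_def using nbhd0_Cp_point[OF x] by simp
  then obtain A where A: "\<And>n. finite (A n)" "CX X \<subseteq> (\<Union>n. set_plus_of (A n) (U n))"
    using assms[unfolded M_bounded_def, rule_format, of U] by auto
  \<comment> \<open>The summand 1 is the radius used in \<open>U n\<close>, and inserting 0 keeps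
    the maximum defined when \<open>A n\<close> is empty.\<close>
  obtain h where h: "h \<in> CX X" "\<And>n. h (x n) = 1 + Max (insert 0 ((\<lambda>a. a (x n)) ` A n))"
    using interpolating_CX[OF ip, of "\<lambda>n. 1 + Max (insert 0 ((\<lambda>a. a (x n)) ` A n))"] by blast
  obtain n a u where n: "a \<in> A n" "u \<in> U n" "h = a + u"
    using A(2) h(1) unfolding set_plus_of_def by blast
  have "a (x n) \<le> Max (insert 0 ((\<lambda>a. a (x n)) ` A n))"
    using A(1) n(1) by (intro Max_ge) auto
  moreover have "h (x n) < a (x n) + 1"
    using n by (auto simp: U_def)
  ultimately show False
    using h(2)[of n] by linarith
qed

section \<open>Tightness\<close>

lemma first_countable_imp_strictly_Frechet_Urysohn:
  assumes "first_countable Y"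
  shows "strictly_Frechet_Urysohn Y"
  unfolding strictly_Frechet_Urysohn_def
proof (intro allI impI)
  fix A :: "nat \<Rightarrow> 'a set" and y
  assume A: "\<forall>n. A n \<subseteq> topspace Y \<and> y \<in> Y closure_of A n"
  then have y: "y \<in> topspace Y"
    by (simp add: in_closure_of)
  then obtain \<B> where \<B>: "countable \<B>" "\<And>V. V \<in> \<B> \<Longrightarrow> openin Y V"
    "\<And>U. openin Y U \<Longrightarrow> y \<in> U \<Longrightarrow> \<exists>V\<in>\<B>. y \<in> V \<and> V \<subseteq> U"
    using assms unfolding first_countable_def by meson
  define \<C> where "\<C> = {V \<in> \<B>. y \<in> V}"
  have \<C>: "\<C> \<noteq> {}" "countable \<C>"
    using \<B>(3)[of "topspace Y"] y \<B>(1) by (auto simp: \<C>_def)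
  \<comment> \<open>Finite intersections turn the countable local base into a decreasing one, so a
    choice from \<open>A n\<close> inside \<open>V n\<close> stays in each base set from some index
    on.\<close>
  define V where "V = (\<lambda>n. \<Inter>k\<le>n. from_nat_into \<C> k)"
  have in\<C>: "from_nat_into \<C> k \<in> \<C>" for k
    using \<C>(1) by (rule from_nat_into)
  have "openin Y (V n)" "y \<in> V n" for n
    using in\<C> \<B>(2) unfolding V_def by (auto intro!: openin_Inter simp: \<C>_def)
  then have "\<exists>a. a \<in> A n \<and> a \<in> V n" for n
    using A unfolding in_closure_of by blast
  then obtain a where a: "\<And>n. a n \<in> A n" "\<And>n. a n \<in> V n"
    by metis
  have "limitin Y a y sequentially"
    unfolding limitin_def
  proof (intro conjI allI impI y)
    fix U assume "openin Y U \<and> y \<in> U"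
    then obtain W where W: "W \<in> \<C>" "W \<subseteq> U"
      using \<B>(3) by (auto simp: \<C>_def)
    then obtain k where k: "W = from_nat_into \<C> k"
      using \<C> by (metis from_nat_into_surj)
    have "a n \<in> U" if "k \<le> n" for n
      using a(2)[of n] that W(2) k by (auto simp: V_def)
    then show "\<forall>\<^sub>F n in sequentially. a n \<in> U"
      by (rule eventually_sequentiallyI)
  qed
  with a(1) show "\<exists>a. (\<forall>n. a n \<in> A n) \<and> limitin Y a y sequentially"
    by blast
qed

lemma limitin_imp_in_closure_of_range:
  assumes "limitin Y a y sequentially" "range a \<subseteq> topspace Y"
  shows "y \<in> Y closure_of range a"
  unfolding in_closure_of
proof (intro conjI allI impI)
  show "y \<in> topspace Y"
    using assms(1) by (rule limitin_topspace)
  fix T assume "y \<in> T \<and> openin Y T"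
  then have "\<forall>\<^sub>F n in sequentially. a n \<in> T"
    using assms(1) by (auto simp: limitin_def)
  then show "\<exists>z. z \<in> range a \<and> z \<in> T"
    using eventually_imp_ex by blast
qed

lemma strictly_Frechet_Urysohn_imp_countable_strong_fan_tightness:
  assumes "strictly_Frechet_Urysohn Y"
  shows "countable_strong_fan_tightness Y"
  unfolding countable_strong_fan_tightness_def
proof (intro allI impI)
  fix A :: "nat \<Rightarrow> 'a set" and y
  assume A: "\<forall>n. A n \<subseteq> topspace Y \<and> y \<in> Y closure_of A n"
  then obtain a where "\<And>n. a n \<in> A n" "limitin Y a y sequentially"
    using assms[unfolded strictly_Frechet_Urysohn_def, rule_format, of A y] by auto
  with A show "\<exists>b. (\<forall>n. b n \<in> A n) \<and> y \<in> Y closure_of range b"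
    by (intro exI[of _ a] conjI limitin_imp_in_closure_of_range) auto
qed

lemma countable_strong_fan_tightness_imp_countable_fan_tightness:
  assumes "countable_strong_fan_tightness Y"
  shows "countable_fan_tightness Y"
  unfolding countable_fan_tightness_def
proof (intro allI impI)
  fix A :: "nat \<Rightarrow> 'a set" and y
  assume "\<forall>n. A n \<subseteq> topspace Y \<and> y \<in> Y closure_of A n"
  then obtain b where "\<And>n. b n \<in> A n" "y \<in> Y closure_of range b"
    using assms[unfolded countable_strong_fan_tightness_def, rule_format, of A y] by auto
  then show "\<exists>B. (\<forall>n. finite (B n) \<and> B n \<subseteq> A n) \<and> y \<in> Y closure_of (\<Union>n. B n)"
    by (intro exI[of _ "\<lambda>n. {b n}"]) (auto simp: UNION_singleton_eq_range)
qed

text \<open>Apply fan tightness to the constant sequence \<open>A\<close>; a countable union of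
  finite sets is countable.\<close>

lemma countable_fan_tightness_imp_countable_tightness:
  assumes "countable_fan_tightness Y"
  shows "countable_tightness Y"
  unfolding countable_tightness_def
proof (intro allI impI)
  fix A y assume "A \<subseteq> topspace Y \<and> y \<in> Y closure_of A"
  then obtain B where "\<And>n::nat. finite (B n) \<and> B n \<subseteq> A" "y \<in> Y closure_of (\<Union>n. B n)"
    using assms[unfolded countable_fan_tightness_def, rule_format, of "\<lambda>_. A" y] by auto
  then show "\<exists>B. B \<subseteq> A \<and> countable B \<and> y \<in> Y closure_of B"
    by (intro exI[of _ "\<Union>n. B n"]) (auto intro: countable_finite)
qed

text \<open>Every gauge dominates a positive function, namely its own half, but for countably many
  positive functions \<open>b n\<close> one gauge can exclude all of them.\<close>

lemma countable_tightness_Cm_imp_pseudocompact: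
  assumes "countable_tightness (Cm X)"
  shows "pseudocompact X"
proof (rule ccontr)
  assume "\<not> pseudocompact X"
  then obtain x where ip: "interpolating X x"
    using not_pseudocompact_imp_interpolating by blast
  note x = interpolating_in_topspace[OF ip]
  define A where "A = {g \<in> CX X. \<forall>y\<in>topspace X. g y > 0}"
  have "0 \<in> Cm X closure_of A"
    unfolding in_closure_of_Cm
  proof (intro conjI ballI impI CX_zero)
    fix e assume e: "e \<in> CX X" "\<forall>x\<in>topspace X. 0 < e x"
    have "(\<lambda>x. e x * (if x \<in> topspace X then 1/2 else 0)) \<in> CX X"
      using e(1) by (intro CX_mult CX_const)
    then show "\<exists>a\<in>A \<inter> CX X. \<forall>x\<in>topspace X. \<bar>a x - 0 x\<bar> < e x"
      using e(2) by (intro bexI[of _ "\<lambda>x. e x * (if x \<in> topspace X then 1/2 else 0)"]) (auto simp: A_def)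
  qed
  then obtain B where B: "B \<subseteq> A" "countable B" "0 \<in> Cm X closure_of B"
    using assms[unfolded countable_tightness_def, rule_format, of A 0] by (auto simp: A_def)
  have "B \<noteq> {}"
    using B(3) by auto
  then obtain b :: "nat \<Rightarrow> 'a \<Rightarrow> real" where b: "B = range b"
    using B(2) uncountable_def by blast
  have pos: "b n (x n) > 0" for n
    using B(1) x b by (auto simp: A_def)
  \<comment> \<open>The gauge equals \<open>b n\<close> at \<open>x n\<close>, so the strict
    inequality required of \<open>b n\<close> fails there.\<close>
  obtain e where e: "e \<in> CX X" "\<And>y. y \<in> topspace X \<Longrightarrow> e y > 0" "\<And>n. e (x n) = b n (x n)"
    using interpolating_CX_pos[OF ip, of "\<lambda>n. b n (x n)"] pos by blast
  then obtain n where "\<forall>y\<in>topspace X. \<bar>b n y - 0 y\<bar> < e y"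
    using B(3) b unfolding in_closure_of_Cm by blast
  with x[of n] have "\<bar>b n (x n)\<bar> < e (x n)"
    by fastforce
  with e(3) show False
    by simp
qed

section \<open>Complete metrizability, Cech-completeness and Baire subspaces\<close>

text \<open>The reciprocal of \<open>e\<close> is continuous, hence bounded, and the inverse of its
  bound lies below \<open>e\<close>.\<close>

lemma pseudocompact_positive_lower_bound:
  assumes "pseudocompact X" "continuous_map X euclideanreal e" "\<And>x. x \<in> topspace X \<Longrightarrow> e x > 0"
  shows "\<exists>\<delta>>0. \<forall>x\<in>topspace X. \<delta> \<le> e x"
proof -
  have "continuous_map X euclideanreal (\<lambda>x. inverse (e x))"
    using assms(2,3) by (intro continuous_map_real_inverse) force+
  then have "bounded ((\<lambda>x. inverse (e x)) ` topspace X)"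
    using assms(1) by (simp add: pseudocompact_def)
  then obtain B where B: "B > 0" "\<And>x. x \<in> topspace X \<Longrightarrow> \<bar>inverse (e x)\<bar> \<le> B"
    unfolding bounded_pos by auto
  have "inverse B \<le> e x" if "x \<in> topspace X" for x
  proof -
    have "inverse (e x) \<le> B"
      using B(2)[OF that] by linarith
    then show ?thesis
      using assms(3)[OF that] B(1) by (simp add: field_simps)
  qed
  with B(1) show ?thesis
    by (intro exI[of _ "inverse B"]) auto
qed

text \<open>All continuous functions are bounded and every gauge dominates a positive constant, so
  \<open>Cm X\<close> is homeomorphic to the bounded continuous functions with the supremum metric,
  which is complete because the reals are.\<close>

lemma pseudocompact_imp_completely_metrizable_Cm:
  assumes "pseudocompact X"
  shows "completely_metrizable_space (Cm X)"
proof -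
  define m where "m = cfunspace X (euclidean_metric :: real metric)"
  interpret Metric_space "mspace m" "mdist m"
    by (rule Metric_space_mspace_mdist)
  \<comment> \<open>The two spaces differ in their default off the carrier: members of
    \<open>mspace m\<close> are extensional, those of \<open>CX X\<close> are 0 there. The maps
    \<open>r\<close> and \<open>i\<close> exchange the defaults.\<close>
  define r where "r = (\<lambda>f :: 'a \<Rightarrow> real. restrict f (topspace X))"
  define i where "i = (\<lambda>g :: 'a \<Rightarrow> real. \<lambda>x. if x \<in> topspace X then g x else 0)"
  have "mcomplete_of m"
    using Met_TC.mcomplete_cfunspace[where 'a = real, of X] complete_UNIV
    by (simp add: m_def euclidean_metric_def Met_TC.Self_def)
  then have "completely_metrizable_space mtopology"
    by (simp add: mcomplete_of_def completely_metrizable_space_mtopology)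
  moreover have r_in: "r f \<in> mspace m" if f: "f \<in> CX X" for f
  proof -
    have "continuous_map X euclideanreal f"
      using f by (rule CX_continuous_map)
    then have "continuous_map X euclideanreal (r f)" "bounded (f ` topspace X)"
      using assms unfolding r_def pseudocompact_def by (auto elim: continuous_map_eq)
    moreover have "r f ` topspace X = f ` topspace X"
      by (auto simp: r_def)
    ultimately show ?thesis
      by (simp add: m_def) (simp add: r_def)
  qed
  have i_in: "i g \<in> CX X" if "g \<in> mspace m" for g
    unfolding i_def using that by (intro CX_extend_zero) (simp add: m_def)
  have dist_le: "\<bar>g x - h x\<bar> \<le> mdist m g h"
    if "g \<in> mspace m" "h \<in> mspace m" "x \<in> topspace X" for g h x
    using mdist_cfunspace_imp_mdist_le[OF that(1,2)[unfolded m_def] order_refl that(3)]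
    by (simp add: m_def dist_real_def)
  have "homeomorphic_maps (Cm X) mtopology r i"
    unfolding homeomorphic_maps_def
  proof (intro conjI ballI)
    show "continuous_map (Cm X) mtopology r"
      unfolding continuous_map_to_metric
    proof (intro ballI allI impI)
      fix f and \<epsilon> :: real assume "f \<in> topspace (Cm X)" and \<epsilon>: "\<epsilon> > 0"
      then have f: "f \<in> CX X"
        by simp
      \<comment> \<open>Half of the radius is used because a pointwise strict bound only gives a
        weak bound on the supremum.\<close>
      define U where "U = {g \<in> CX X. \<forall>x\<in>topspace X. \<bar>g x - f x\<bar> < (if x \<in> topspace X then \<epsilon> / 2 else 0)}"
      have "r g \<in> mball (r f) \<epsilon>" if "g \<in> U" for g
      proof -
        have g: "g \<in> CX X" "\<And>x. x \<in> topspace X \<Longrightarrow> \<bar>g x - f x\<bar> < \<epsilon> / 2"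
          using that by (auto simp: U_def)
        have "mdist m (r f) (r g) \<le> \<epsilon> / 2"
          unfolding m_def
        proof (rule mdist_cfunspace_le)
          show "mdist euclidean_metric (r f x) (r g x) \<le> \<epsilon> / 2" if "x \<in> topspace X" for x
            using g(2)[OF that] that by (simp add: r_def dist_real_def abs_minus_commute)
        qed (use \<epsilon> in simp)
        then show ?thesis
          using \<epsilon> r_in f g(1) by simp
      qed
      moreover have "openin (Cm X) U"
        unfolding U_def by (rule openin_Cm_ball[OF f CX_const])
      moreover have "f \<in> U"
        using f \<epsilon> by (auto simp: U_def)
      ultimately show "\<exists>U. openin (Cm X) U \<and> f \<in> U \<and> (\<forall>g\<in>U. r g \<in> mball (r f) \<epsilon>)"
        by blast
    qed
    show "continuous_map mtopology (Cm X) i"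
      unfolding continuous_map_def
    proof (intro conjI allI impI)
      show "i \<in> topspace mtopology \<rightarrow> topspace (Cm X)"
        using i_in by auto
      fix U assume U: "openin (Cm X) U"
      show "openin mtopology {g \<in> topspace mtopology. i g \<in> U}"
        unfolding openin_mtopology
      proof (intro conjI allI impI)
        fix g assume "g \<in> {g \<in> topspace mtopology. i g \<in> U}"
        then have g: "g \<in> mspace m" "i g \<in> U"
          by auto
        then obtain e where e: "e \<in> CX X" "\<forall>x\<in>topspace X. e x > 0"
          "{h \<in> CX X. \<forall>x\<in>topspace X. \<bar>h x - i g x\<bar> < e x} \<subseteq> U"
          using U unfolding openin_Cm by blast
        then obtain \<delta> where \<delta>: "\<delta> > 0" "\<And>x. x \<in> topspace X \<Longrightarrow> \<delta> \<le> e x"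
          using pseudocompact_positive_lower_bound[OF assms CX_continuous_map[OF e(1)]] by auto
        have "i h \<in> U" if h: "h \<in> mspace m" "mdist m g h < \<delta>" for h
        proof -
          have "\<bar>i h x - i g x\<bar> < e x" if x: "x \<in> topspace X" for x
            using dist_le[OF g(1) h(1) x] h(2) \<delta>(2)[OF x] x by (simp add: i_def abs_minus_commute)
          then show ?thesis
            using e(3) i_in[OF h(1)] by auto
        qed
        then have "mball g \<delta> \<subseteq> {g \<in> topspace mtopology. i g \<in> U}"
          by auto
        then show "\<exists>\<delta>>0. mball g \<delta> \<subseteq> {g \<in> topspace mtopology. i g \<in> U}"
          using \<delta>(1) by blast
      qed auto
    qed
    show "i (r f) = f" if "f \<in> topspace (Cm X)" for f
      using that by (auto simp: i_def r_def CX_def fun_eq_iff)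
    show "r (i g) = g" if "g \<in> topspace mtopology" for g
      using that unfolding topspace_mtopology
      by (auto simp: i_def r_def m_def fun_eq_iff extensional_def)
  qed
  then have "Cm X homeomorphic_space mtopology"
    by (rule homeomorphic_maps_imp_homeomorphic_space)
  ultimately show ?thesis
    using homeomorphic_completely_metrizable_space by blast
qed

section \<open>The Stone-Cech compactification: compactness, density and the lifting of open
  sets\<close>

lemma topspace_Stone_Cech:
  "topspace (Stone_Cech Y) = beta_cube Y closure_of (beta_embed Y ` topspace Y)"
  unfolding Stone_Cech_def by (simp add: closure_of_subset_topspace inf_absorb2)

lemma continuous_map_beta_embed_cube: "continuous_map Y (beta_cube Y) (beta_embed Y)"
  unfolding beta_cube_def continuous_map_componentwise
  by (auto simp: beta_embed_def beta_index_def)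

lemma beta_embed_image_subset: "beta_embed Y ` topspace Y \<subseteq> topspace (Stone_Cech Y)"
  unfolding topspace_Stone_Cech
  by (intro closure_of_subset continuous_map_image_subset_topspace continuous_map_beta_embed_cube)

lemma continuous_map_beta_embed: "continuous_map Y (Stone_Cech Y) (beta_embed Y)"
  using beta_embed_image_subset[of Y] continuous_map_beta_embed_cube[of Y]
  unfolding topspace_Stone_Cech
  by (auto simp: Stone_Cech_def continuous_map_in_subtopology)

lemma compact_Stone_Cech: "compact_space (Stone_Cech Y)"
proof -
  have "compact_space (top_of_set {0..1::real})"
    by (simp add: compact_space_subtopology)
  then have "compact_space (beta_cube Y)"
    unfolding beta_cube_def compact_space_product_topology by simp
  then show ?thesis
    unfolding Stone_Cech_def
    by (intro compact_space_subtopology closedin_compact_space closedin_closure_of)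
qed

lemma Hausdorff_Stone_Cech: "Hausdorff_space (Stone_Cech Y)"
  unfolding Stone_Cech_def beta_cube_def
  by (intro Hausdorff_space_subtopology)
    (simp add: Hausdorff_space_product_topology Hausdorff_space_subtopology)

lemma dense_beta_embed:
  "Stone_Cech Y closure_of (beta_embed Y ` topspace Y) = topspace (Stone_Cech Y)"
proof -
  let ?E = "beta_embed Y ` topspace Y"
  have "?E \<subseteq> beta_cube Y closure_of ?E"
    using beta_embed_image_subset[of Y] unfolding topspace_Stone_Cech .
  then show ?thesis
    unfolding topspace_Stone_Cech
    by (simp add: Stone_Cech_def closure_of_subtopology inf_absorb2)
qed

text \<open>This also stands in for injectivity of \<open>beta_embed\<close>, which is never needed.\<close>
lemma openin_eq_vimage_beta_embed:
  assumes "completely_regular_space Y" "openin Y U"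
  shows "\<exists>W. openin (Stone_Cech Y) W \<and> U = {y \<in> topspace Y. beta_embed Y y \<in> W}"
proof -
  define W where "W = (\<lambda>f. {p \<in> topspace (Stone_Cech Y). p f < 1})"
  have opW: "openin (Stone_Cech Y) (W f)" if f: "f \<in> beta_index Y" for f
  proof -
    have "continuous_map (beta_cube Y) (top_of_set {0..1}) (\<lambda>p. p f)"
      unfolding beta_cube_def using f by (rule continuous_map_product_projection)
    then have "continuous_map (Stone_Cech Y) euclideanreal (\<lambda>p. p f)"
      unfolding Stone_Cech_def
      by (intro continuous_map_from_subtopology) (simp add: continuous_map_in_subtopology)
    then have "openin (Stone_Cech Y) {p \<in> topspace (Stone_Cech Y). p f \<in> {..<1}}"
      by (rule openin_continuous_map_preimage) auto
    then show ?thesis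
      by (simp add: W_def)
  qed
  \<comment> \<open>Complete regularity gives each point of \<open>U\<close> a member of
    \<open>\<F>\<close> vanishing there, while off \<open>U\<close> all members equal 1. Hence the
    union of the sets \<open>W f\<close> pulls back exactly to \<open>U\<close>.\<close>
  define \<F> where "\<F> = {f \<in> beta_index Y. \<forall>y\<in>topspace Y - U. f y = 1}"
  have "\<exists>f\<in>\<F>. f y < 1" if "y \<in> U" for y
  proof -
    have "closedin Y (topspace Y - U)" "y \<in> topspace Y - (topspace Y - U)"
      using assms(2) that openin_subset by auto
    then obtain f where "continuous_map Y (top_of_set {0..1::real}) f" "f y = 0"
      "f ` (topspace Y - U) \<subseteq> {1}"
      using assms(1) unfolding completely_regular_space_def by metis
    then show ?thesis
      by (intro bexI[of _ f]) (auto simp: \<F>_def beta_index_def)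
  qed
  moreover have "beta_embed Y y \<in> W f \<longleftrightarrow> f y < 1" if "y \<in> topspace Y" "f \<in> \<F>" for y f
    using that beta_embed_image_subset[of Y] by (auto simp: W_def beta_embed_def \<F>_def)
  moreover have "U \<subseteq> topspace Y"
    using assms(2) by (rule openin_subset)
  moreover have "y \<in> U" if "y \<in> topspace Y" "f \<in> \<F>" "f y < 1" for y f
    using that by (force simp: \<F>_def)
  ultimately have "U = {y \<in> topspace Y. beta_embed Y y \<in> (\<Union>f\<in>\<F>. W f)}"
    by (intro set_eqI iffI) (simp_all, blast+)
  moreover have "openin (Stone_Cech Y) (\<Union>f\<in>\<F>. W f)"
    using opW by (intro openin_Union) (auto simp: \<F>_def)
  ultimately show ?thesis
    by blast
qed

text \<open>The image of \<open>Y\<close> is written as an intersection of open sets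
  \<open>G n\<close>. That it lies in each \<open>G n\<close> uses only small balls; that nothing
  else does uses completeness.\<close>

lemma completely_metrizable_imp_Cech_complete:
  assumes "completely_metrizable_space Y"
  shows "Cech_complete Y"
proof -
  obtain M d where "Metric_space M d" "Metric_space.mcomplete M d" "Y = Metric_space.mtopology M d"
    using assms unfolding completely_metrizable_space_def by blast
  then interpret Metric_space M d
    by simp
  have mcomp: mcomplete and Y: "Y = mtopology"
    by fact+
  have metr: "metrizable_space Y"
    using assms by (rule completely_metrizable_imp_metrizable_space)
  then have Tych: "Tychonoff_space Y"
    by (simp add: Tychonoff_space_def metrizable_imp_completely_regular_space metrizable_imp_Hausdorff_space)
  let ?Z = "Stone_Cech Y" and ?e = "beta_embed Y"
  \<comment> \<open>A point of all \<open>G n\<close> has neighbourhoods with arbitrarily small traces on \<open>Y\<close>, hence defines a Cauchy sequence in \<open>Y\<close>.\<close>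
  define small where "small = (\<lambda>n N. openin ?Z N \<and>
     (\<forall>x\<in>M. \<forall>y\<in>M. ?e x \<in> N \<longrightarrow> ?e y \<in> N \<longrightarrow> d x y \<le> inverse (real (Suc n))))"
  define G where "G = (\<lambda>n. \<Union>{N. small n N})"
  have opG: "openin ?Z (G n)" for n
    unfolding G_def by (intro openin_Union) (auto simp: small_def)
  have lift: "\<exists>W. openin ?Z W \<and> U = {y \<in> M. ?e y \<in> W}" if "openin Y U" for U
    using openin_eq_vimage_beta_embed[OF _ that] metrizable_imp_completely_regular_space[OF metr]
    by (simp add: Y)
  have sub: "?e y \<in> G n" if y: "y \<in> M" for y n
  proof -
    obtain W where W: "openin ?Z W" "mball y (inverse (real (Suc n)) / 2) = {x \<in> M. ?e x \<in> W}"
      using lift[of "mball y (inverse (real (Suc n)) / 2)"] by (auto simp: Y)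
    have "d a b \<le> inverse (real (Suc n))" if "a \<in> M" "b \<in> M" "?e a \<in> W" "?e b \<in> W" for a b
    proof -
      have "a \<in> mball y (inverse (real (Suc n)) / 2)" "b \<in> mball y (inverse (real (Suc n)) / 2)"
        using that W(2) by auto
      then have "d y a < inverse (real (Suc n)) / 2" "d y b < inverse (real (Suc n)) / 2"
        by auto
      then show ?thesis
        using triangle[OF that(1) y that(2)] commute[of a y] by linarith
    qed
    then have "small n W"
      using W(1) by (simp add: small_def)
    moreover have "y \<in> mball y (inverse (real (Suc n)) / 2)"
      using y by simp
    ultimately show ?thesis
      using W(2) by (auto simp: G_def)
  qed
  \<comment> \<open>The points \<open>s n\<close> are taken in the traces of finite intersections of
    the \<open>N' k\<close>. They form a Cauchy sequence, and \<open>p\<close> turns out to be the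
    image of its limit.\<close>
  have sup: "p \<in> ?e ` M" if p: "\<And>n. p \<in> G n" for p
  proof -
    have "\<exists>N. small n N \<and> p \<in> N" for n
      using p[of n] by (auto simp: G_def)
    then obtain N' where N': "\<And>n. small n (N' n)" "\<And>n. p \<in> N' n"
      by metis
    have pZ: "p \<in> topspace ?Z"
      using N'(1)[of 0] N'(2)[of 0] openin_subset by (fastforce simp: small_def)
    have meets: "\<exists>y\<in>M. ?e y \<in> P" if "openin ?Z P" "p \<in> P" for P
      using pZ that dense_beta_embed[of Y] by (auto simp: in_closure_of set_eq_iff Y)
    have opO: "openin ?Z (\<Inter>k\<le>n. N' k)" for n
      using N'(1) by (intro openin_Inter) (auto simp: small_def)
    have "\<exists>y\<in>M. ?e y \<in> (\<Inter>k\<le>n. N' k)" for n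
      using meets[OF opO] N'(2) by auto
    then obtain s where s: "\<And>n. s n \<in> M" "\<And>n k. k \<le> n \<Longrightarrow> ?e (s n) \<in> N' k"
      by (metis INT_E atMost_iff)
    have close: "d x (s n) \<le> inverse (real (Suc k))" if "x \<in> M" "?e x \<in> N' k" "k \<le> n" for x n k
      using N'(1)[of k] s that by (simp add: small_def)
    have "MCauchy s"
      unfolding MCauchy_def
    proof (intro conjI allI impI)
      show "range s \<subseteq> M"
        using s(1) by auto
      fix \<epsilon> :: real assume "\<epsilon> > 0"
      then obtain k where k: "inverse (real (Suc k)) < \<epsilon>"
        using reals_Archimedean by blast
      have "d (s n) (s n') < \<epsilon>" if "k \<le> n" "k \<le> n'" for n n'
        using close[OF s(1) s(2)[OF that(1)] that(2)] k by linarith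
      then show "\<exists>N. \<forall>n n'. N \<le> n \<longrightarrow> N \<le> n' \<longrightarrow> d (s n) (s n') < \<epsilon>"
        by blast
    qed
    then obtain y where y: "limitin mtopology s y sequentially"
      using mcomp unfolding mcomplete_def by blast
    then have yM: "y \<in> M"
      using limitin_topspace by fastforce
    have "p = ?e y"
    proof (rule ccontr)
      \<comment> \<open>Separate \<open>p\<close> from the image of \<open>y\<close>. A point
        \<open>z\<close> whose image is in \<open>P\<close> and in a small neighbourhood of
        \<open>p\<close> is close to late \<open>s n\<close>, hence to \<open>y\<close>, so its
        image also falls into \<open>Q\<close>.\<close>
      assume "p \<noteq> ?e y"
      moreover have "?e y \<in> topspace ?Z"
        using beta_embed_image_subset[of Y] yM by (auto simp: Y)
      ultimately obtain P Q where PQ: "openin ?Z P" "openin ?Z Q" "p \<in> P" "?e y \<in> Q" "disjnt P Q"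
        using Hausdorff_Stone_Cech[of Y] pZ unfolding Hausdorff_space_def by blast
      have "openin mtopology {x \<in> topspace Y. ?e x \<in> Q}"
        using openin_continuous_map_preimage[OF continuous_map_beta_embed PQ(2)] by (simp add: Y)
      then obtain \<epsilon> where \<epsilon>: "\<epsilon> > 0" "mball y \<epsilon> \<subseteq> {x \<in> topspace Y. ?e x \<in> Q}"
        unfolding openin_mtopology using yM PQ(4) by (auto simp: Y)
      obtain k where k: "inverse (real (Suc k)) < \<epsilon> / 2"
        using reals_Archimedean[of "\<epsilon> / 2"] \<epsilon>(1) by auto
      obtain z where z: "z \<in> M" "?e z \<in> P \<inter> N' k"
        using meets[of "P \<inter> N' k"] PQ N' by (auto simp: small_def openin_Int)
      have "\<forall>\<^sub>F n in sequentially. s n \<in> M \<and> d (s n) y < \<epsilon> / 2"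
        using y half_gt_zero[OF \<epsilon>(1)] unfolding limitin_metric by blast
      then obtain N where N: "\<And>n. N \<le> n \<Longrightarrow> d (s n) y < \<epsilon> / 2"
        unfolding eventually_sequentially by blast
      have "d z (s (max N k)) < \<epsilon> / 2"
        using close[of z k "max N k"] z k by auto
      with N[of "max N k"] have "d y z < \<epsilon>"
        using triangle[OF z(1) s(1)[of "max N k"] yM] commute[of y z] by simp
      then have "?e z \<in> Q"
        using \<epsilon>(2) z(1) yM by auto
      with z(2) PQ(5) show False
        by (auto simp: disjnt_iff)
    qed
    with yM show ?thesis
      by blast
  qed
  have "?e ` topspace Y = (\<Inter>n. G n)"
    using sub sup by (auto simp: Y)
  moreover have "gdelta_in ?Z (\<Inter>n. G n)"
    using opG by (intro gdelta_in_Inter) (auto intro: open_imp_gdelta_in)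
  ultimately show ?thesis
    using Tych by (simp add: Cech_complete_def)
qed

text \<open>Dense open sets of \<open>C\<close> lift to dense open sets of a compact Hausdorff
  space. Intersecting also with the open sets that cut out \<open>Y\<close> forces the points
  obtained there to come from \<open>Y\<close>.\<close>

lemma Cech_complete_imp_hereditarily_Baire:
  assumes "Cech_complete Y"
  shows "hereditarily_Baire Y"
  unfolding hereditarily_Baire_def Baire_space_def
proof (intro allI impI)
  fix C and G :: "nat \<Rightarrow> 'a set"
  let ?T = "subtopology Y C" and ?Z = "Stone_Cech Y" and ?e = "beta_embed Y"
  assume C: "closedin Y C" and G: "\<forall>n. openin ?T (G n) \<and> ?T closure_of G n = topspace ?T"
  have CY: "C \<subseteq> topspace Y"
    using C by (rule closedin_subset)
  then have topT: "topspace ?T = C"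
    by auto
  have lift: "\<exists>W. openin ?Z W \<and> U = {y \<in> topspace Y. ?e y \<in> W}" if "openin Y U" for U
    using openin_eq_vimage_beta_embed[OF _ that] assms by (simp add: Cech_complete_def Tychonoff_space_def)
  obtain D where D: "\<And>n::nat. openin ?Z (D n)" "(\<Inter>n. D n) = ?e ` topspace Y"
    using assms unfolding Cech_complete_def gdelta_in_descending by blast
  \<comment> \<open>The Baire category theorem is applied in the compact set \<open>K\<close>, where the \<open>D n\<close> cut out the image of \<open>C\<close>.\<close>
  define K where "K = ?Z closure_of (?e ` C)"
  define S where "S = subtopology ?Z K"
  have eC: "?e ` C \<subseteq> K"
    unfolding K_def using beta_embed_image_subset[of Y] CY by (intro closure_of_subset) auto
  have KZ: "K \<subseteq> topspace ?Z"
    by (simp add: K_def closure_of_subset_topspace)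
  then have topS: "topspace S = K"
    by (auto simp: S_def)
  have "compact_space S"
    unfolding S_def K_def
    by (intro compact_space_subtopology closedin_compact_space compact_Stone_Cech closedin_closure_of)
  moreover have "Hausdorff_space S"
    unfolding S_def by (intro Hausdorff_space_subtopology Hausdorff_Stone_Cech)
  ultimately have S: "locally_compact_space S \<and> regular_space S"
    by (simp add: compact_imp_locally_compact_space compact_Hausdorff_imp_regular_space)
  have contT: "continuous_map ?T S ?e"
    unfolding S_def using eC CY
    by (auto simp: continuous_map_in_subtopology intro: continuous_map_from_subtopology continuous_map_beta_embed)
  have eC_dense: "S closure_of (?e ` C) = K"
    using eC by (simp add: S_def closure_of_subtopology inf_absorb2 K_def)
  \<comment> \<open>The image of a dense subset of \<open>C\<close> is dense in the image of
    \<open>C\<close>, which is itself dense in \<open>K\<close>.\<close>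
  have dense: "S closure_of A = topspace S" if A: "?T closure_of B = C" "?e ` B \<subseteq> A" for A B
  proof -
    have "?e ` C \<subseteq> S closure_of (?e ` B)"
      using continuous_map_image_closure_subset[OF contT, of B] A(1) by simp
    also have "\<dots> \<subseteq> S closure_of A"
      using A(2) by (rule closure_of_mono)
    finally have "S closure_of (?e ` C) \<subseteq> S closure_of A"
      by (simp add: closure_of_minimal)
    then show ?thesis
      using eC_dense topS closure_of_subset_topspace[of S A] by auto
  qed
  have "\<exists>W. openin ?Z W \<and> G n = {y \<in> C. ?e y \<in> W}" for n
  proof -
    obtain U where "openin Y U" "G n = U \<inter> C"
      using G unfolding openin_subtopology by blast
    with lift[of U] CY show ?thesis
      by blast
  qed
  then obtain W where W: "\<And>n. openin ?Z (W n)" "\<And>n. G n = {y \<in> C. ?e y \<in> W n}"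
    by metis
  \<comment> \<open>The \<open>D n\<close> make a point of \<open>I\<close> the image of a point of
    \<open>Y\<close>, and the \<open>W n\<close> place that point in every \<open>G n\<close> once
    it is known to lie in \<open>C\<close>.\<close>
  define I where "I = \<Inter>(range (\<lambda>n. W n \<inter> K) \<union> range (\<lambda>n. D n \<inter> K))"
  have "S closure_of I = topspace S"
    unfolding I_def
  proof (rule Baire_category)
    fix T assume "T \<in> range (\<lambda>n. W n \<inter> K) \<union> range (\<lambda>n. D n \<inter> K)"
    then consider n where "T = W n \<inter> K" | n where "T = D n \<inter> K"
      by auto
    then show "openin S T \<and> S closure_of T = topspace S"
    proof cases
      case 1
      have "?e ` G n \<subseteq> T"
        using 1 W(2)[of n] eC by auto
      moreover have "?T closure_of G n = C"
        using G topT by simp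
      ultimately have "S closure_of T = topspace S"
        using dense by blast
      with W(1)[of n] 1 show ?thesis
        by (simp add: S_def openin_subtopology_Int)
    next
      case 2
      have "?e ` C \<subseteq> T"
        using 2 D(2) CY eC by auto
      moreover have "?T closure_of C = C"
        using closure_of_topspace[of ?T] topT by simp
      ultimately have "S closure_of T = topspace S"
        using dense by blast
      with D(1)[of n] 2 show ?thesis
        by (simp add: S_def openin_subtopology_Int)
    qed
  qed (use S in auto)
  then have Baire: "S closure_of I = K"
    by (simp add: topS)
  \<comment> \<open>The complement of the closed set \<open>C\<close> lifts to an open set missing
    the image of \<open>C\<close>, hence missing its closure \<open>K\<close>.\<close>
  have mem: "y \<in> C" if y: "y \<in> topspace Y" "?e y \<in> K" for y
  proof (rule ccontr)
    assume "y \<notin> C"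
    obtain V where V: "openin ?Z V" "topspace Y - C = {y \<in> topspace Y. ?e y \<in> V}"
      using lift[of "topspace Y - C"] C by (auto simp: openin_diff)
    then have "?e y \<in> V"
      using y \<open>y \<notin> C\<close> by blast
    then obtain c where "c \<in> C" "?e c \<in> V"
      using y(2) V(1) by (auto simp: K_def in_closure_of)
    with V(2) CY show False
      by blast
  qed
  have "y \<in> ?T closure_of (\<Inter>n. G n)" if y: "y \<in> C" for y
    unfolding in_closure_of
  proof (intro conjI allI impI)
    show "y \<in> topspace ?T"
      using y topT by simp
    fix T assume T: "y \<in> T \<and> openin ?T T"
    then obtain U where U: "openin Y U" "T = U \<inter> C"
      unfolding openin_subtopology by blast
    obtain V where V: "openin ?Z V" "U = {y \<in> topspace Y. ?e y \<in> V}"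
      using lift[OF U(1)] by blast
    have "?e y \<in> K" "?e y \<in> V" "openin S (V \<inter> K)"
      using eC y T U V by (auto simp: S_def openin_subtopology)
    moreover have "?e y \<in> S closure_of I"
      using Baire eC y by auto
    ultimately obtain p where "p \<in> I" "p \<in> V" "p \<in> K"
      unfolding in_closure_of by blast
    then have p: "p \<in> V" "p \<in> K" "\<And>n. p \<in> W n" "\<And>n. p \<in> D n"
      by (auto simp: I_def)
    then obtain z where z: "z \<in> topspace Y" "p = ?e z"
      using D(2) by blast
    with p mem have "z \<in> C"
      by blast
    with p z U V W(2) show "\<exists>z. z \<in> (\<Inter>n. G n) \<and> z \<in> T"
      by (intro exI[of _ z]) auto
  qed
  then show "?T closure_of (\<Inter>n. G n) = topspace ?T"
    using closure_of_subset_topspace[of ?T] topT by blast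
qed

text \<open>In the closed set \<open>Z\<close> of functions with finite support along
  \<open>x\<close>, the sets \<open>V n\<close> trace dense open sets, yet a common member would
  have infinite support.\<close>

lemma hereditarily_Baire_Cm_imp_pseudocompact:
  assumes "hereditarily_Baire (Cm X)"
  shows "pseudocompact X"
proof (rule ccontr)
  assume "\<not> pseudocompact X"
  then obtain x where ip: "interpolating X x"
    using not_pseudocompact_imp_interpolating by blast
  note x = interpolating_in_topspace[OF ip]
  define Z where "Z = {h \<in> CX X. finite {n. h (x n) \<noteq> 0}}"
  define V where "V = (\<lambda>n. {h \<in> CX X. \<exists>k\<ge>n. h (x k) \<noteq> 0})"
  have Z_sub: "Z \<subseteq> CX X"
    by (auto simp: Z_def)
  have "closedin (Cm X) Z"
    unfolding closure_of_subset_eq[symmetric] topspace_Cm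
  proof (intro conjI subsetI)
    fix g assume g: "g \<in> Cm X closure_of Z"
    \<comment> \<open>A function closer to \<open>g\<close> than this gauge cannot vanish at
      \<open>x n\<close> where \<open>g\<close> does not, so its finite support bounds that of
      \<open>g\<close>. The value 1 only keeps the gauge positive.\<close>
    have "(if g (x n) = 0 then 1 else \<bar>g (x n)\<bar>) > 0" for n
      by simp
    from interpolating_CX_pos[OF ip, of "\<lambda>n. if g (x n) = 0 then 1 else \<bar>g (x n)\<bar>", OF this]
    obtain e where e: "e \<in> CX X" "\<forall>y\<in>topspace X. e y > 0"
      "\<And>n. e (x n) = (if g (x n) = 0 then 1 else \<bar>g (x n)\<bar>)"
      by blast
    then obtain a where a: "a \<in> Z" "\<forall>y\<in>topspace X. \<bar>a y - g y\<bar> < e y"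
      using g unfolding in_closure_of_Cm by blast
    have "a (x n) \<noteq> 0" if "g (x n) \<noteq> 0" for n
      using a(2)[rule_format, OF x[of n]] e(3)[of n] that by auto
    then have "{n. g (x n) \<noteq> 0} \<subseteq> {n. a (x n) \<noteq> 0}"
      by blast
    moreover have "finite {n. a (x n) \<noteq> 0}"
      using a(1) by (simp add: Z_def)
    ultimately have "finite {n. g (x n) \<noteq> 0}"
      by (rule finite_subset)
    then show "g \<in> Z"
      using g by (simp add: Z_def in_closure_of_Cm)
  qed (use Z_sub in auto)
  then have Baire: "Baire_space (subtopology (Cm X) Z)"
    using assms by (simp add: hereditarily_Baire_def)
  have topZ: "topspace (subtopology (Cm X) Z) = Z"
    using Z_sub by auto
  have "openin (Cm X) (V n)" for n
    unfolding openin_Cm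
  proof (intro conjI ballI)
    fix f assume "f \<in> V n"
    then obtain k where k: "k \<ge> n" "f (x k) \<noteq> 0"
      by (auto simp: V_def)
    have "g \<in> V n"
      if "g \<in> CX X" "\<forall>y\<in>topspace X. \<bar>g y - f y\<bar> < (if y \<in> topspace X then \<bar>f (x k)\<bar> else 0)" for g
    proof -
      have "g (x k) \<noteq> 0"
        using that(2)[rule_format, OF x[of k]] x[of k] by auto
      with that(1) k(1) show ?thesis
        by (auto simp: V_def)
    qed
    then show "\<exists>e\<in>CX X. (\<forall>y\<in>topspace X. 0 < e y) \<and>
        {g \<in> CX X. \<forall>y\<in>topspace X. \<bar>g y - f y\<bar> < e y} \<subseteq> V n"
      using k(2) by (intro bexI[OF _ CX_const[of X "\<bar>f (x k)\<bar>"]]) auto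
  qed (auto simp: V_def)
  then have opV: "openin (subtopology (Cm X) Z) (Z \<inter> V n)" for n
    by (rule openin_subtopology_Int2)
  have dense: "h \<in> Cm X closure_of (Z \<inter> V n)" if h: "h \<in> Z" for h n
    unfolding in_closure_of_Cm
  proof (intro conjI ballI impI)
    show hC: "h \<in> CX X"
      using h Z_sub by blast
    fix e assume e: "e \<in> CX X" "\<forall>y\<in>topspace X. 0 < e y"
    show "\<exists>a\<in>Z \<inter> V n \<inter> CX X. \<forall>y\<in>topspace X. \<bar>a y - h y\<bar> < e y"
    proof (cases "h (x n) = 0")
      case False
      with h hC e(2) show ?thesis
        by (intro bexI[of _ h]) (auto simp: V_def)
    next
      case True
      obtain v where v: "v \<in> CX X" "\<And>j. v (x j) = (if j = n then 1 else 0)"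
        using interpolating_CX[OF ip, of "\<lambda>j. if j = n then 1 else 0"] by auto
      \<comment> \<open>The perturbation vanishes at every \<open>x j\<close> except
        \<open>x n\<close>, where it equals half of the gauge. Truncating \<open>v\<close> at 1
        keeps it below the gauge everywhere.\<close>
      define u where "u = (\<lambda>y. e y / 2 * min 1 \<bar>v y\<bar>)"
      define a where "a = (\<lambda>y. h y + u y)"
      have u: "\<bar>u y\<bar> < e y" if "y \<in> topspace X" for y
      proof -
        have "\<bar>u y\<bar> \<le> e y / 2 * 1"
          unfolding u_def abs_mult using e(2)[rule_format, OF that] by (intro mult_mono) auto
        with e(2)[rule_format, OF that] show ?thesis
          by simp
      qed
      have "u \<in> CX X"
        using e(1) v(1) by (auto simp: CX_def u_def intro!: continuous_intros)
      then have aC: "a \<in> CX X"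
        unfolding a_def using hC by (intro CX_add)
      have "{j. a (x j) \<noteq> 0} \<subseteq> insert n {j. h (x j) \<noteq> 0}"
        by (auto simp: a_def u_def v(2))
      then have "finite {j. a (x j) \<noteq> 0}"
        by (rule finite_subset) (use h in \<open>simp add: Z_def\<close>)
      moreover have "a (x n) \<noteq> 0"
        using True e(2)[rule_format, OF x[of n]] by (simp add: a_def u_def v(2))
      ultimately show ?thesis
        using aC u by (intro bexI[of _ a]) (auto simp: Z_def V_def, simp add: a_def)
    qed
  qed
  have "subtopology (Cm X) Z closure_of (Z \<inter> V n) = Z" for n
    using dense Z_sub by (auto simp: closure_of_subtopology)
  with opV have "subtopology (Cm X) Z closure_of (\<Inter>n. Z \<inter> V n) = Z"
    by (intro Baire[unfolded Baire_space_def topZ, rule_format] conjI)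
  moreover have "(\<Inter>n. Z \<inter> V n) = {}"
  proof (rule ccontr)
    assume "(\<Inter>n. Z \<inter> V n) \<noteq> {}"
    then obtain h where h: "h \<in> Z" "\<And>n. h \<in> V n"
      by auto
    have "\<exists>k\<ge>n. k \<in> {n. h (x n) \<noteq> 0}" for n
      using h(2)[of n] by (auto simp: V_def)
    then have "infinite {n. h (x n) \<noteq> 0}"
      unfolding infinite_nat_iff_unbounded_le by blast
    with h(1) show False
      by (simp add: Z_def)
  qed
  ultimately have "Z = {}"
    by simp
  moreover have "0 \<in> Z"
    using CX_zero by (simp add: Z_def)
  ultimately show False
    by blast
qed

theorem theorem2p2:
  fixes X :: "'a topology"
  assumes "Tychonoff_space X"
  shows "(strictly_H_bounded (Cp X) \<longleftrightarrow> H_bounded (Cp X)) \<and>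
         (H_bounded (Cp X) \<longleftrightarrow> strictly_M_bounded (Cp X)) \<and>
         (strictly_M_bounded (Cp X) \<longleftrightarrow> M_bounded (Cp X)) \<and>
         (M_bounded (Cp X) \<longleftrightarrow> pseudocompact X) \<and>
         (pseudocompact X \<longleftrightarrow> first_countable (Cm X)) \<and>
         (first_countable (Cm X) \<longleftrightarrow> strictly_Frechet_Urysohn (Cm X)) \<and>
         (strictly_Frechet_Urysohn (Cm X) \<longleftrightarrow> countable_strong_fan_tightness (Cm X)) \<and>
         (countable_strong_fan_tightness (Cm X) \<longleftrightarrow> countable_fan_tightness (Cm X)) \<and>
         (countable_fan_tightness (Cm X) \<longleftrightarrow> countable_tightness (Cm X)) \<and>
         (countable_tightness (Cm X) \<longleftrightarrow> completely_metrizable_space (Cm X)) \<and>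
         (completely_metrizable_space (Cm X) \<longleftrightarrow> Cech_complete (Cm X)) \<and>
         (Cech_complete (Cm X) \<longleftrightarrow> hereditarily_Baire (Cm X))"
proof -
  \<comment> \<open>Each condition is reached from \<open>pseudocompact X\<close> and leads back to
    it. The third chain starts at complete metrizability, which the second derives from
    pseudocompactness.\<close>
  note Cp_cycle = pseudocompact_imp_strictly_H_bounded_Cp[of X]
    strictly_H_bounded_imp_H_bounded[of "Cp X"] H_bounded_imp_M_bounded[of "Cp X"]
    strictly_H_bounded_imp_strictly_M_bounded[of "Cp X"]
    strictly_M_bounded_imp_M_bounded[of "Cp X"] M_bounded_Cp_imp_pseudocompact[of X]
  note tightness_cycle = pseudocompact_imp_completely_metrizable_Cm[of X]
    metrizable_imp_first_countable[OF completely_metrizable_imp_metrizable_space, of "Cm X"]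
    first_countable_imp_strictly_Frechet_Urysohn[of "Cm X"]
    strictly_Frechet_Urysohn_imp_countable_strong_fan_tightness[of "Cm X"]
    countable_strong_fan_tightness_imp_countable_fan_tightness[of "Cm X"]
    countable_fan_tightness_imp_countable_tightness[of "Cm X"]
    countable_tightness_Cm_imp_pseudocompact[of X]
  note Baire_cycle = completely_metrizable_imp_Cech_complete[of "Cm X"]
    Cech_complete_imp_hereditarily_Baire[of "Cm X"]
    hereditarily_Baire_Cm_imp_pseudocompact[of X]
  show ?thesis
    using Cp_cycle tightness_cycle Baire_cycle by argo
qed

end
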